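(* Let $n_1,\dots,n_k\ge 2$ be pairwise coprime integers. Then the type graph $\Gamma^T(\mathbb{Z}_{n_1}\times\cdots\times\mathbb{Z}_{n_k})$ is isomorphic to the type graph $\Gamma^T(\mathbb{Z}_{n_1n_2\cdots n_k})$.
   Context: For integers $n_1,\dots,n_k\ge2$, the type graph $\Gamma^T(\mathbb{Z}_{n_1}\times\cdots\times\mathbb{Z}_{n_k})$ is the simple graph defined as follows. Its vertices are the type classes $T(x_1,\dots,x_k)$, where each $x_i$ is either $0$ or a positive divisor of $n_i$ with $x_i<n_i$ (so $x_i=1$ is allowed), and $(x_1,\dots,x_k)$ is neither $(0,\dots,0)$ nor $(1,\dots,1)$. Here $T(x_1,\dots,x_k)$ is the set of tuples $(a_1,\dots,a_k)$ with $a_i=0$ if $x_i=0$, and $a_i\neq0$ with $\gcd(a_i,n_i)=x_i$ if $x_i\neq 0$. Two distinct vertices $T(x)$ and $T(y)$ are adjacent iff $x_iy_i\equiv 0\pmod{n_i}$ for all $i$. In particular (case $k=1$), for $n\ge2$ the type graph $\Gamma^T(\mathbb{Z}_n)$ has vertices $T_a=\{x\in\mathbb{Z}_n\setminus\{0\}:\gcd(x,n)=a\}$ for the divisors $a$ of $n$ with $1<a<n$, with $T_a,T_b$ ($a\ne b$) adjacent iff $ab\equiv0\pmod n$. *)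

theory Defs
  imports "HOL-Number_Theory.Residues" "HOL-Algebra.Chinese_Remainder" "Graph_Theory.Graph_Theory"
begin

text \<open>
  The tuple \<open>(n\<^sub>1, \<dots>, n\<^sub>k)\<close> is a list \<open>ns\<close>, and elements of \<open>\<int>_{n\<^sub>1} \<times> \<dots> \<times> \<int>_{n\<^sub>k}\<close>
  are lists of standard representatives (\<open>residue_ring n\<close> has carrier \<open>{0..n - 1}\<close>).
\<close>

definition zmod_prod :: "int list \<Rightarrow> int list ring" where
  "zmod_prod ns = RDirProd_list (map residue_ring ns)"

definition type_class_prod :: "int list \<Rightarrow> int list \<Rightarrow> int list set" where
  "type_class_prod ns xs =
     {as \<in> carrier (zmod_prod ns). \<forall>i<length ns.
        (xs ! i = 0 \<longrightarrow> as ! i = 0) \<and>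
        (xs ! i \<noteq> 0 \<longrightarrow> as ! i \<noteq> 0 \<and> gcd (as ! i) (ns ! i) = xs ! i)}"

definition type_labels :: "int list \<Rightarrow> int list set" where
  "type_labels ns =
     {xs. length xs = length ns \<and>
        (\<forall>i<length ns. xs ! i = 0 \<or> (0 < xs ! i \<and> xs ! i dvd ns ! i \<and> xs ! i < ns ! i)) \<and>
        xs \<noteq> replicate (length ns) 0 \<and> xs \<noteq> replicate (length ns) 1}"

text \<open>
  Simple graphs are represented, as in the library, by symmetric loop-free digraphs
  without parallel arcs: each edge contributes its two orientations.
\<close>

definition type_graph_prod :: "int list \<Rightarrow> (int list set, int list set \<times> int list set) pre_digraph" where
  "type_graph_prod ns =
     \<lparr> verts = type_class_prod ns ` type_labels ns,
       arcs = {(type_class_prod ns xs, type_class_prod ns ys) | xs ys.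
                 xs \<in> type_labels ns \<and> ys \<in> type_labels ns \<and>
                 type_class_prod ns xs \<noteq> type_class_prod ns ys \<and>
                 (\<forall>i<length ns. [xs ! i * ys ! i = 0] (mod ns ! i))},
       tail = fst, head = snd \<rparr>"

definition zmod_type_class :: "int \<Rightarrow> int \<Rightarrow> int set" where
  "zmod_type_class n a = {x \<in> carrier (residue_ring n) - {0}. gcd x n = a}"

definition proper_divisors :: "int \<Rightarrow> int set" where
  "proper_divisors n = {a. a dvd n \<and> 1 < a \<and> a < n}"

definition type_graph :: "int \<Rightarrow> (int set, int set \<times> int set) pre_digraph" where
  "type_graph n =
     \<lparr> verts = zmod_type_class n ` proper_divisors n,
       arcs = {(zmod_type_class n a, zmod_type_class n b) | a b.
                 a \<in> proper_divisors n \<and> b \<in> proper_divisors n \<and> a \<noteq> b \<and> [a * b = 0] (mod n)},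
       tail = fst, head = snd \<rparr>"

lemma carrier_residue_ring: "carrier (residue_ring n) = {0..n - 1}"
  by (simp add: residue_ring_def)

lemma carrier_zmod_prod:
  "carrier (zmod_prod ns) =
     {as. length as = length ns \<and> (\<forall>i<length ns. as ! i \<in> carrier (residue_ring (ns ! i)))}"
  unfolding zmod_prod_def
  using RDirProd_list_carrier_mem[of _ "map residue_ring ns"]
  by (auto intro!: RDirProd_list_carrier_memI)

lemma finite_zmod_prod: "finite (carrier (zmod_prod ns))"
proof -
  have "carrier (zmod_prod ns) \<subseteq>
      {as. set as \<subseteq> (\<Union>n\<in>set ns. {0..n - 1}) \<and> length as = length ns}"
    by (fastforce simp: carrier_zmod_prod carrier_residue_ring in_set_conv_nth)
  then show ?thesis
    by (rule finite_subset) (intro finite_lists_length_eq finite_UN_I, auto)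
qed

lemma sym_pairI: "(\<And>x y. P x y \<Longrightarrow> P y x) \<Longrightarrow> sym {(f x, f y) | x y. P x y}"
  unfolding sym_def by blast

lemma graph_type_graph_prod: "graph (type_graph_prod ns)"
proof -
  let ?G = "type_graph_prod ns"
  have V: "finite (verts ?G)"
    by (rule finite_subset[of _ "Pow (carrier (zmod_prod ns))"])
       (auto simp: type_graph_prod_def type_class_prod_def finite_zmod_prod)
  have A: "arcs ?G \<subseteq> verts ?G \<times> verts ?G"
    by (auto simp: type_graph_prod_def)
  have S: "sym (arcs ?G)"
    unfolding type_graph_prod_def by (auto intro!: sym_pairI simp: mult.commute)
  show ?thesis
    using V A S finite_subset[OF A]
    by unfold_locales
       (auto simp: type_graph_prod_def arc_to_ends_def symmetric_def arcs_ends_conv)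
qed

lemma zmod_type_class_self:
  assumes "a \<in> proper_divisors n"
  shows "a \<in> zmod_type_class n a"
  using assms by (simp add: zmod_type_class_def proper_divisors_def carrier_residue_ring gcd_proj1_if_dvd_int)

lemma zmod_type_class_eq_iff:
  assumes "a \<in> proper_divisors n" "b \<in> proper_divisors n"
  shows "zmod_type_class n a = zmod_type_class n b \<longleftrightarrow> a = b"
proof
  assume "zmod_type_class n a = zmod_type_class n b"
  with zmod_type_class_self[OF assms(1)]
  have "a \<in> zmod_type_class n a" "a \<in> zmod_type_class n b"
    by simp_all
  then have "gcd a n = a" "gcd a n = b"
    by (simp_all add: zmod_type_class_def)
  then show "a = b"
    by simp
qed simp

lemma graph_type_graph: "graph (type_graph n)"
proof -
  let ?G = "type_graph n"
  have V: "finite (verts ?G)"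
    by (rule finite_subset[of _ "Pow {0..n - 1}"])
       (auto simp: type_graph_def zmod_type_class_def carrier_residue_ring)
  have A: "arcs ?G \<subseteq> verts ?G \<times> verts ?G"
    by (auto simp: type_graph_def)
  have S: "sym (arcs ?G)"
    unfolding type_graph_def by (auto intro!: sym_pairI simp: mult.commute)
  show ?thesis
    using V A S finite_subset[OF A]
    by unfold_locales
       (auto simp: type_graph_def arc_to_ends_def symmetric_def arcs_ends_conv zmod_type_class_eq_iff)
qed

text \<open>\<open>type_graph\<close> is \<open>type_graph_prod\<close> for a single factor, with 1-tuples written as elements.\<close>

lemma type_labels_single: "type_labels [n] = (\<lambda>a. [a]) ` proper_divisors n"
  by (auto simp: type_labels_def proper_divisors_def length_Suc_conv)

lemma type_class_prod_single:
  assumes "a \<in> proper_divisors n"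
  shows "type_class_prod [n] [a] = (\<lambda>x. [x]) ` zmod_type_class n a"
proof -
  have "0 < a"
    using assms by (simp add: proper_divisors_def)
  then have "as \<in> type_class_prod [n] [a] \<longleftrightarrow> (\<exists>x. as = [x] \<and> x \<in> zmod_type_class n a)" for as
    by (cases as) (auto simp: type_class_prod_def zmod_type_class_def carrier_zmod_prod)
  then show ?thesis
    by blast
qed

lemma type_graph_single: "digraph_iso (type_graph n) (type_graph_prod [n])"
proof -
  let ?f = "(`) (\<lambda>x. [x]) :: int set \<Rightarrow> int list set"
  let ?h = "\<lparr> iso_verts = ?f, iso_arcs = map_prod ?f ?f, iso_head = snd, iso_tail = fst \<rparr>"
  have inj: "inj ?f"
    by (rule inj_on_image) (simp add: inj_on_def)
  interpret graph "type_graph n"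
    by (rule graph_type_graph)
  have "digraph_isomorphism ?h"
    unfolding digraph_isomorphism_def
    using wf_digraph inj_on_subset[OF inj subset_UNIV]
      inj_on_subset[OF prod.inj_map[OF inj inj] subset_UNIV]
    by (simp add: type_graph_def split_beta)
  moreover have "verts (type_graph_prod [n]) = ?f ` verts (type_graph n)"
    by (simp add: type_graph_prod_def type_graph_def type_labels_single type_class_prod_single
        image_image cong: image_cong_simp)
  moreover have "arcs (type_graph_prod [n]) = map_prod ?f ?f ` arcs (type_graph n)" (is "?L = ?R")
  proof -
    have ne: "?f (zmod_type_class n a) = ?f (zmod_type_class n b) \<longleftrightarrow> a = b"
      if "a \<in> proper_divisors n" "b \<in> proper_divisors n" for a b
      using that inj by (simp add: inj_eq zmod_type_class_eq_iff)
    have "p \<in> ?L \<longleftrightarrow> p \<in> ?R" for p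
    proof -
      have "p \<in> ?L \<longleftrightarrow> (\<exists>xs\<in>type_labels [n]. \<exists>ys\<in>type_labels [n].
          p = (type_class_prod [n] xs, type_class_prod [n] ys) \<and>
          type_class_prod [n] xs \<noteq> type_class_prod [n] ys \<and> [xs ! 0 * ys ! 0 = 0] (mod n))"
        unfolding type_graph_prod_def by (simp add: Bex_def) blast
      also have "\<dots> \<longleftrightarrow> (\<exists>a\<in>proper_divisors n. \<exists>b\<in>proper_divisors n.
          p = (?f (zmod_type_class n a), ?f (zmod_type_class n b)) \<and> a \<noteq> b \<and> [a * b = 0] (mod n))"
        unfolding type_labels_single by (simp add: ne type_class_prod_single cong: bex_cong)
      also have "\<dots> \<longleftrightarrow> p \<in> ?R"
        unfolding type_graph_def image_iff by (simp add: Bex_def) blast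
      finally show ?thesis .
    qed
    then show ?thesis
      by blast
  qed
  ultimately show ?thesis
    unfolding digraph_iso_def
    by (intro exI[of _ ?h]) (simp add: app_iso_def type_graph_prod_def)
qed

end

(* A label x determines the divisor given by the product of the gcd (x_i, n_i) of n_1 ... n_k; the
   entry 0 thus plays the role of n_i.  Modulo n_i the numbers x_i and gcd (x_i, n_i) agree on
   labels, and coprimality recovers gcd (x_i, n_i) as the gcd of the divisor with n_i.  This makes
   the correspondence bijective, with the zero and the all-one label matching the improper divisors
   n_1 ... n_k and 1, and since n_i divides a b iff it divides gcd (a, n_i) gcd (b, n_i), it
   respects adjacency. *)
theory Submission
  imports Defs
begin

section \<open>Digraph isomorphisms from bijections of labels\<close>

text \<open>Reduces the isomorphism to a statement about labels: since \<open>p\<close> is injective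
  on \<open>X\<close>, the bijection \<open>f\<close> transports to the vertex map sending
  \<open>p x\<close> to \<open>q (f x)\<close>. Arcs are pairs of vertices, so this map also
  determines the arc map.\<close>

lemma digraph_iso_labelled:
  assumes G: "wf_digraph G" "verts G = p ` X" "tail G = fst" "head G = snd"
      "arcs G = {(p x, p y) | x y. x \<in> X \<and> y \<in> X \<and> R x y}"
    and H: "verts H = q ` Y" "tail H = fst" "head H = snd"
      "arcs H = {(q x, q y) | x y. x \<in> Y \<and> y \<in> Y \<and> S x y}"
    and p: "inj_on p X" and q: "inj_on q Y" and f: "bij_betw f X Y"
    and RS: "\<And>x y. x \<in> X \<Longrightarrow> y \<in> X \<Longrightarrow> R x y \<longleftrightarrow> S (f x) (f y)"
  shows "digraph_iso G (H :: ('c, 'c \<times> 'c) pre_digraph)"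
proof -
  define h where "h = q \<circ> f \<circ> the_inv_into X p"
  have h: "h (p x) = q (f x)" if "x \<in> X" for x
    using that by (simp add: h_def the_inv_into_f_f[OF p])
  have fY: "f x \<in> Y" if "x \<in> X" for x
    using that f by (auto simp: bij_betw_def)
  have Yf: "\<exists>x\<in>X. y = f x" if "y \<in> Y" for y
    using that f by (auto simp: bij_betw_def)
  have inj: "inj_on h (p ` X)"
  proof (rule inj_onI, clarify)
    fix x y assume "x \<in> X" "y \<in> X" "h (p x) = h (p y)"
    then have "f x = f y"
      using inj_onD[OF q] by (simp add: h fY)
    with \<open>x \<in> X\<close> \<open>y \<in> X\<close> show "p x = p y"
      using inj_onD[OF bij_betw_imp_inj_on[OF f]] by blast
  qed
  \<comment> \<open>Needed for injectivity on arcs: \<open>map_prod h h\<close> is only known to be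
    injective on \<open>p\<close> X \<times> p \<open>X\<close>.\<close>
  have arcs: "arcs G \<subseteq> p ` X \<times> p ` X"
    unfolding G(5) by auto
  let ?h = "\<lparr> iso_verts = h, iso_arcs = map_prod h h, iso_head = snd, iso_tail = fst \<rparr>"
  have "pre_digraph.digraph_isomorphism G ?h"
    unfolding pre_digraph.digraph_isomorphism_def
    using G(1) inj inj_on_subset[OF map_prod_inj_on[OF inj inj] arcs]
    by (simp add: G)
  moreover have "verts H = h ` verts G"
    by (simp add: G(2) H(1) image_image h image_image[of q f, symmetric]
        bij_betw_imp_surj_on[OF f] cong: image_cong_simp)
  moreover have "arcs H = map_prod h h ` arcs G"
  proof (intro equalityI subsetI)
    fix e assume "e \<in> arcs H"
    then obtain y y' where "y \<in> Y" "y' \<in> Y" "S y y'" "e = (q y, q y')"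
      unfolding H(4) by blast
    moreover from this obtain x x' where "x \<in> X" "x' \<in> X" "y = f x" "y' = f x'"
      using Yf by blast
    ultimately have "e = map_prod h h (p x, p x')" "(p x, p x') \<in> arcs G"
      using RS[of x x'] by (auto simp: h G(5))
    then show "e \<in> map_prod h h ` arcs G"
      by blast
  next
    fix e assume "e \<in> map_prod h h ` arcs G"
    then obtain x x' where "x \<in> X" "x' \<in> X" "R x x'" "e = (q (f x), q (f x'))"
      unfolding G(5) by (auto simp: h)
    with RS fY show "e \<in> arcs H"
      unfolding H(4) by blast
  qed
  ultimately show ?thesis
    unfolding digraph_iso_def
    by (intro exI[of _ ?h]) (simp add: app_iso_def H)
qed

section \<open>Divisibility and gcds of coprime products\<close>

lemma prod_dvd_coprime:
  fixes n :: "'i \<Rightarrow> 'a :: semiring_gcd"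
  assumes "\<And>i j. i \<in> A \<Longrightarrow> j \<in> A \<Longrightarrow> i \<noteq> j \<Longrightarrow> coprime (n i) (n j)"
    and "\<And>i. i \<in> A \<Longrightarrow> n i dvd c"
  shows "prod n A dvd c"
  using assms
proof (induction A rule: infinite_finite_induct)
  case (insert j A)
  then have "coprime (n j) (prod n A)"
    by (intro prod_coprime_right) auto
  with insert show ?case
    by (simp add: divides_mult)
qed simp_all

text \<open>The product of the factors other than \<open>d j\<close> is coprime to \<open>m\<close>
  and so cancels inside the gcd.\<close>

lemma gcd_prod_coprime_cancel:
  fixes d :: "'i \<Rightarrow> 'a :: semiring_gcd"
  assumes "finite A" "j \<in> A" "\<And>i. i \<in> A \<Longrightarrow> i \<noteq> j \<Longrightarrow> coprime (d i) m"
  shows "gcd (prod d A) m = gcd (d j) m"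
proof -
  have "coprime m (prod d (A - {j}))"
    using assms by (intro prod_coprime_right) (auto simp: coprime_commute)
  then show ?thesis
    using assms by (simp add: prod.remove[of A j] gcd_mult_left_right_cancel)
qed

text \<open>If \<open>n\<close> divides \<open>a * b\<close>, it also divides \<open>b * n\<close>,
  hence their gcd \<open>b * gcd a n\<close>; the same argument applied to the other factor replaces
  \<open>b\<close> by \<open>gcd b n\<close>.\<close>

lemma dvd_mult_gcd_iff:
  fixes n :: "'a :: semiring_gcd"
  shows "n dvd gcd a n * gcd b n \<longleftrightarrow> n dvd a * b"
proof
  assume "n dvd gcd a n * gcd b n"
  then show "n dvd a * b"
    by (rule dvd_trans) (simp add: mult_dvd_mono)
next
  assume "n dvd a * b"
  then have "n dvd gcd (b * a) (b * n)"
    by (simp add: mult.commute)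
  then have "n dvd gcd a n * b"
    unfolding gcd_mult_left dvd_normalize_iff by (simp add: mult.commute)
  then have "n dvd gcd (gcd a n * b) (gcd a n * n)"
    by simp
  then show "n dvd gcd a n * gcd b n"
    unfolding gcd_mult_left dvd_normalize_iff .
qed

section \<open>Divisors of a product of coprime moduli\<close>

definition label_divisor :: "int list \<Rightarrow> int list \<Rightarrow> int" where
  "label_divisor ns xs = (\<Prod>i<length ns. gcd (xs ! i) (ns ! i))"

locale coprime_moduli =
  fixes ns :: "int list"
  assumes ge2: "i < length ns \<Longrightarrow> ns ! i \<ge> 2"
    and coprime: "i < length ns \<Longrightarrow> j < length ns \<Longrightarrow> i \<noteq> j \<Longrightarrow> coprime (ns ! i) (ns ! j)"
begin

lemma prod_list_eq: "prod_list ns = (\<Prod>i<length ns. ns ! i)"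
  by (simp add: prod.list_conv_set_nth atLeast0LessThan)

lemma prod_list_pos: "prod_list ns > 0"
  unfolding prod_list_eq by (rule prod_pos) (auto dest: ge2)

lemma nth_dvd_prod_list: "i < length ns \<Longrightarrow> ns ! i dvd prod_list ns"
  by (simp add: prod_list_eq dvd_prodI)

lemma prod_list_dvd_iff: "prod_list ns dvd c \<longleftrightarrow> (\<forall>i<length ns. ns ! i dvd c)"
proof
  assume "\<forall>i<length ns. ns ! i dvd c"
  then show "prod_list ns dvd c"
    unfolding prod_list_eq by (intro prod_dvd_coprime) (auto intro: coprime)
qed (auto intro: dvd_trans[OF nth_dvd_prod_list])

text \<open>The factors with index other than \<open>j\<close> divide moduli coprime to
  \<open>ns ! j\<close> and drop out. The list \<open>xs\<close> is arbitrary, so this applies to a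
  candidate before it is known to be a label.\<close>

lemma gcd_label_divisor:
  assumes "j < length ns"
  shows "gcd (label_divisor ns xs) (ns ! j) = gcd (xs ! j) (ns ! j)"
proof -
  have "coprime (gcd (xs ! i) (ns ! i)) (ns ! j)" if "i < length ns" "i \<noteq> j" for i
    using coprime[OF that(1) assms that(2)] by (rule coprime_divisors[rotated 2]) simp_all
  then show ?thesis
    using gcd_prod_coprime_cancel[of "{..<length ns}" j "\<lambda>i. gcd (xs ! i) (ns ! i)"] assms
    by (simp add: label_divisor_def gcd.assoc)
qed

text \<open>Local divisibility is lifted without prime factorizations. With
  \<open>c = prod_list ns div a\<close>, each modulus divides \<open>c * a\<close> and
  \<open>c * ns ! i\<close>, hence \<open>c * gcd a (ns ! i)\<close> and \<open>c * b\<close>. By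
  coprimality \<open>c * a\<close> divides \<open>c * b\<close>, and \<open>c\<close>
  cancels.\<close>

lemma dvd_prod_listI:
  assumes "a dvd prod_list ns"
    and "\<And>i. i < length ns \<Longrightarrow> gcd a (ns ! i) dvd b"
  shows "a dvd b"
proof -
  have "ns ! i dvd (prod_list ns div a) * b" if "i < length ns" for i
  proof -
    let ?n = "ns ! i" and ?c = "prod_list ns div a"
    have "?n dvd ?c * a"
      using assms(1) nth_dvd_prod_list[OF that] by simp
    then have "?n dvd gcd (?c * a) (?c * ?n)"
      by simp
    then have "?n dvd ?c * gcd a ?n"
      unfolding gcd_mult_left dvd_normalize_iff .
    also have "\<dots> dvd ?c * b"
      using assms(2)[OF that] by simp
    finally show ?thesis .
  qed
  then have "prod_list ns dvd (prod_list ns div a) * b"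
    by (simp add: prod_list_dvd_iff)
  then have "(prod_list ns div a) * a dvd (prod_list ns div a) * b"
    using assms(1) by simp
  moreover have "prod_list ns div a \<noteq> 0"
    using assms(1) prod_list_pos by (simp add: dvd_div_eq_0_iff)
  ultimately show ?thesis
    by simp
qed

text \<open>The common gcds divide both numbers, so \<open>a\<close> and \<open>b\<close> divide
  each other; positivity fixes the sign.\<close>

lemma divisor_eqI:
  assumes "a dvd prod_list ns" "b dvd prod_list ns" "a > 0" "b > 0"
    and "\<And>i. i < length ns \<Longrightarrow> gcd a (ns ! i) = gcd b (ns ! i)"
  shows "a = b"
proof (rule zdvd_antisym_nonneg)
  show "a dvd b"
    using assms(1) by (rule dvd_prod_listI) (simp add: assms(5))
  show "b dvd a"
    using assms(2) by (rule dvd_prod_listI) (simp flip: assms(5))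
qed (use assms(3,4) in simp_all)

lemma label_divisor_dvd: "label_divisor ns xs dvd prod_list ns"
  unfolding label_divisor_def prod_list_eq by (rule prod_dvd_prod) simp

lemma label_divisor_pos: "label_divisor ns xs > 0"
  unfolding label_divisor_def
  by (rule prod_pos) (auto dest: ge2)

section \<open>Type classes and their labels\<close>

lemma type_class_prod_self:
  assumes "xs \<in> type_labels ns"
  shows "xs \<in> type_class_prod ns xs"
proof -
  have "0 \<le> xs ! i \<and> xs ! i < ns ! i" "xs ! i \<noteq> 0 \<Longrightarrow> gcd (xs ! i) (ns ! i) = xs ! i"
    if "i < length ns" for i
    using assms ge2[OF that] that by (auto simp: type_labels_def)
  moreover have "length xs = length ns"
    using assms by (simp add: type_labels_def)
  ultimately show ?thesis
    by (simp add: type_class_prod_def carrier_zmod_prod carrier_residue_ring)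
qed

text \<open>A label represents its own class. If the classes agree, \<open>xs\<close> also satisfies
  the conditions for \<open>ys\<close>, which force equal entries.\<close>

lemma inj_on_type_class_prod: "inj_on (type_class_prod ns) (type_labels ns)"
proof (rule inj_onI)
  fix xs ys
  assume xs: "xs \<in> type_labels ns" and ys: "ys \<in> type_labels ns"
    and eq: "type_class_prod ns xs = type_class_prod ns ys"
  have "xs \<in> type_class_prod ns xs" "xs \<in> type_class_prod ns ys"
    using type_class_prod_self[OF xs] by (simp_all add: eq)
  then have "(xs ! i = 0 \<longleftrightarrow> ys ! i = 0) \<and>
      (ys ! i \<noteq> 0 \<longrightarrow> xs ! i = gcd (xs ! i) (ns ! i) \<and> gcd (xs ! i) (ns ! i) = ys ! i)"
    if "i < length ns" for i
    using that unfolding type_class_prod_def mem_Collect_eq by metis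
  then have "xs ! i = ys ! i" if "i < length ns" for i
    using that by metis
  with xs ys show "xs = ys"
    by (intro nth_equalityI) (auto simp: type_labels_def)
qed

section \<open>Bijection between labels and proper divisors\<close>

text \<open>Recovers a label from its divisor: reduction modulo \<open>ns ! i\<close> sends the gcd
  \<open>ns ! i\<close> back to the entry 0 and fixes every smaller positive divisor.\<close>

lemma label_nth_eq:
  assumes "xs \<in> type_labels ns" "i < length ns"
  shows "xs ! i = gcd (label_divisor ns xs) (ns ! i) mod ns ! i"
proof (cases "xs ! i = 0")
  case False
  then have "0 < xs ! i" "xs ! i dvd ns ! i" "xs ! i < ns ! i"
    using assms by (auto simp: type_labels_def)
  then show ?thesis
    by (simp add: gcd_label_divisor assms(2))
qed (use ge2[OF assms(2)] in \<open>simp add: gcd_label_divisor assms(2)\<close>)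

lemma label_divisor_eq_iff:
  assumes "xs \<in> type_labels ns" "ys \<in> type_labels ns"
  shows "label_divisor ns xs = label_divisor ns ys \<longleftrightarrow> xs = ys"
proof
  assume "label_divisor ns xs = label_divisor ns ys"
  then have "xs ! i = ys ! i" if "i < length ns" for i
    using label_nth_eq[OF assms(1) that] label_nth_eq[OF assms(2) that] by simp
  with assms show "xs = ys"
    by (intro nth_equalityI) (auto simp: type_labels_def)
qed simp

lemma label_divisor_in_proper_divisors:
  assumes "xs \<in> type_labels ns"
  shows "label_divisor ns xs \<in> proper_divisors (prod_list ns)"
proof -
  have len: "length xs = length ns" and ne: "xs \<noteq> replicate (length ns) 0" "xs \<noteq> replicate (length ns) 1"
    using assms by (auto simp: type_labels_def)
  note nth = label_nth_eq[OF assms]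
  have "label_divisor ns xs \<noteq> prod_list ns"
  proof
    assume "label_divisor ns xs = prod_list ns"
    then have "xs ! i = 0" if "i < length ns" for i
      using nth[OF that] nth_dvd_prod_list[OF that] ge2[OF that]
      by simp
    then show False
      using ne(1) len by (metis length_replicate nth_equalityI nth_replicate)
  qed
  moreover have "label_divisor ns xs \<noteq> 1"
  proof
    assume "label_divisor ns xs = 1"
    \<comment> \<open>All gcds are 1 here, and \<open>1 mod ns ! i\<close> is 1 because the modulus
      is at least 2.\<close>
    then have "xs ! i = 1" if "i < length ns" for i
      using nth[OF that] ge2[OF that] by simp
    then show False
      using ne(2) len by (metis length_replicate nth_equalityI nth_replicate)
  qed
  ultimately show ?thesis
    using label_divisor_dvd[of xs] label_divisor_pos[of xs]
      zdvd_imp_le[OF label_divisor_dvd prod_list_pos, of xs]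
    unfolding proper_divisors_def by (intro CollectI conjI) linarith+
qed

lemma ex_label_divisor_eq:
  assumes "a \<in> proper_divisors (prod_list ns)"
  shows "\<exists>xs\<in>type_labels ns. label_divisor ns xs = a"
proof -
  \<comment> \<open>The only possible preimage, by \<open>label_nth_eq\<close>.\<close>
  define xs where "xs = map (\<lambda>n. gcd a n mod n) ns"
  have a: "a dvd prod_list ns" "1 < a" "a < prod_list ns" "0 < a"
    using assms by (auto simp: proper_divisors_def)
  have "gcd (xs ! i) (ns ! i) = gcd a (ns ! i)" if "i < length ns" for i
  proof -
    \<comment> \<open>One Euclidean step undoes the reduction modulo \<open>ns ! i\<close>.\<close>
    have "gcd (xs ! i) (ns ! i) = gcd (ns ! i) (gcd a (ns ! i) mod ns ! i)"
      using that unfolding xs_def by (subst gcd.commute) simp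
    also have "\<dots> = gcd (gcd a (ns ! i)) (ns ! i)"
      by (rule gcd_red_int[symmetric])
    also have "\<dots> = gcd a (ns ! i)"
      by (simp add: gcd.assoc)
    finally show ?thesis .
  qed
  then have "gcd (label_divisor ns xs) (ns ! i) = gcd a (ns ! i)" if "i < length ns" for i
    using that by (simp add: gcd_label_divisor)
  then have eq: "label_divisor ns xs = a"
    by (rule divisor_eqI[OF label_divisor_dvd a(1) label_divisor_pos a(4)])
  have "xs ! i = 0 \<or> 0 < xs ! i \<and> xs ! i dvd ns ! i \<and> xs ! i < ns ! i" if "i < length ns" for i
  proof (cases "gcd a (ns ! i) = ns ! i")
    case False
    moreover have "gcd a (ns ! i) \<le> ns ! i" "0 < gcd a (ns ! i)"
      using ge2[OF that] by (auto intro: zdvd_imp_le)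
    ultimately have "xs ! i = gcd a (ns ! i)" "gcd a (ns ! i) < ns ! i"
      using that by (simp_all add: xs_def)
    with \<open>0 < gcd a (ns ! i)\<close> show ?thesis
      by (simp only:) simp
  next
    case True
    with that show ?thesis
      by (simp add: xs_def)
  qed
  moreover have "xs \<noteq> replicate (length ns) 0"
  proof
    assume xs0: "xs = replicate (length ns) 0"
    have "label_divisor ns xs = prod_list ns"
      unfolding label_divisor_def prod_list_eq
    proof (rule prod.cong)
      fix i assume "i \<in> {..<length ns}"
      then show "gcd (xs ! i) (ns ! i) = ns ! i"
        using ge2[of i] by (simp add: xs0)
    qed simp
    with eq a(3) show False
      by simp
  qed
  moreover have "xs \<noteq> replicate (length ns) 1"
  proof
    assume "xs = replicate (length ns) 1"
    then have "label_divisor ns xs = 1"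
      by (simp add: label_divisor_def)
    with eq a(2) show False
      by simp
  qed
  ultimately have "xs \<in> type_labels ns"
    by (simp add: type_labels_def xs_def)
  with eq show ?thesis
    by blast
qed

lemma bij_betw_label_divisor:
  "bij_betw (label_divisor ns) (type_labels ns) (proper_divisors (prod_list ns))"
proof (rule bij_betw_imageI)
  show "inj_on (label_divisor ns) (type_labels ns)"
    by (simp add: inj_on_def label_divisor_eq_iff)
  show "label_divisor ns ` type_labels ns = proper_divisors (prod_list ns)"
    using label_divisor_in_proper_divisors by (auto dest: ex_label_divisor_eq)
qed

section \<open>Adjacency and the isomorphism\<close>

text \<open>For each modulus, \<open>dvd_mult_gcd_iff\<close> reduces both sides to divisibility of
  a product of gcds, and these gcds agree by \<open>gcd_label_divisor\<close>.\<close>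

lemma label_divisor_mult_cong_0_iff:
  "[label_divisor ns xs * label_divisor ns ys = 0] (mod prod_list ns) \<longleftrightarrow>
     (\<forall>i<length ns. [xs ! i * ys ! i = 0] (mod ns ! i))"
proof -
  have "ns ! i dvd label_divisor ns xs * label_divisor ns ys \<longleftrightarrow> ns ! i dvd xs ! i * ys ! i"
    if "i < length ns" for i
    using dvd_mult_gcd_iff[of "ns ! i" "label_divisor ns xs" "label_divisor ns ys"]
      dvd_mult_gcd_iff[of "ns ! i" "xs ! i" "ys ! i"]
    unfolding gcd_label_divisor[OF that] by blast
  then show ?thesis
    by (simp add: cong_0_iff prod_list_dvd_iff)
qed

end

theorem theorem1p11:
  fixes ns :: "int list"
  assumes "ns \<noteq> []"
    and "\<forall>i<length ns. ns ! i \<ge> 2"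
    and "\<forall>i<length ns. \<forall>j<length ns. i \<noteq> j \<longrightarrow> coprime (ns ! i) (ns ! j)"
  shows "digraph_iso (type_graph_prod ns) (type_graph (prod_list ns))"
proof -
  interpret coprime_moduli ns
    using assms by unfold_locales auto
  interpret graph "type_graph_prod ns"
    by (rule graph_type_graph_prod)
  \<comment> \<open>Distinctness of classes becomes distinctness of labels, so that adjacency is a
    relation on labels as \<open>digraph_iso_labelled\<close> requires.\<close>
  have arcs: "arcs (type_graph_prod ns) = {(type_class_prod ns xs, type_class_prod ns ys) |xs ys.
      xs \<in> type_labels ns \<and> ys \<in> type_labels ns \<and>
      (xs \<noteq> ys \<and> (\<forall>i<length ns. [xs ! i * ys ! i = 0] (mod ns ! i)))}"
    unfolding type_graph_prod_def pre_digraph.simps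
    by (intro Collect_cong ex_cong1) (metis inj_on_eq_iff[OF inj_on_type_class_prod])
  have inj: "inj_on (zmod_type_class (prod_list ns)) (proper_divisors (prod_list ns))"
    by (simp add: inj_on_def zmod_type_class_eq_iff)
  show ?thesis
  proof (rule digraph_iso_labelled[OF wf_digraph _ _ _ arcs _ _ _ _
        inj_on_type_class_prod inj bij_betw_label_divisor])
    show "arcs (type_graph (prod_list ns)) =
        {(zmod_type_class (prod_list ns) a, zmod_type_class (prod_list ns) b) |a b.
          a \<in> proper_divisors (prod_list ns) \<and> b \<in> proper_divisors (prod_list ns) \<and>
          (a \<noteq> b \<and> [a * b = 0] (mod prod_list ns))}"
      by (simp add: type_graph_def)
    show "xs \<noteq> ys \<and> (\<forall>i<length ns. [xs ! i * ys ! i = 0] (mod ns ! i)) \<longleftrightarrow>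
        label_divisor ns xs \<noteq> label_divisor ns ys \<and>
        [label_divisor ns xs * label_divisor ns ys = 0] (mod prod_list ns)"
      if "xs \<in> type_labels ns" "ys \<in> type_labels ns" for xs ys
      using that by (simp only: label_divisor_eq_iff label_divisor_mult_cong_0_iff)
  qed (simp_all add: type_graph_prod_def type_graph_def)
qed

end
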